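(* Let $q$, $b$, $\lambda$ be indeterminates. For integers $n\ge0$ let $$N'_n=\sum_{k,j\ge0}q^{k^2+k}\lambda^k\begin{bmatrix}k+j\\ k\end{bmatrix}_q\begin{bmatrix}n-k-j\\ k\end{bmatrix}_q(-b)^j,\qquad D'_n=\sum_{k,j\ge0}q^{k^2}\lambda^k\begin{bmatrix}k+j\\ k\end{bmatrix}_q\begin{bmatrix}n-k-j+1\\ k\end{bmatrix}_q(-b)^j.$$ Then $N'_n$ and $D'_n$ are the numerator and denominator polynomials of the $(n+1)$th convergent of the continued fraction $$\frac{1}{1-b}\genfrac{}{}{0pt}{}{}{+}\frac{b+\lambda q}{1-b}\genfrac{}{}{0pt}{}{}{+}\frac{b+\lambda q^2}{1-b}\genfrac{}{}{0pt}{}{}{+}\frac{b+\lambda q^3}{1-b}\genfrac{}{}{0pt}{}{}{+}\cdots,$$ that is, $$\frac{N'_n}{D'_n}=\frac{1}{1-b}\genfrac{}{}{0pt}{}{}{+}\frac{b+\lambda q}{1-b}\genfrac{}{}{0pt}{}{}{+}\frac{b+\lambda q^2}{1-b}\genfrac{}{}{0pt}{}{}{+}\cdots\genfrac{}{}{0pt}{}{}{+}\frac{b+\lambda q^n}{1-b}.$$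
   Context: The notation $\frac{a_0}{b_0}\genfrac{}{}{0pt}{}{}{+}\frac{a_1}{b_1}\genfrac{}{}{0pt}{}{}{+}\cdots\genfrac{}{}{0pt}{}{}{+}\frac{a_n}{b_n}$ denotes the finite continued fraction $\cfrac{a_0}{b_0+\cfrac{a_1}{b_1+\cdots+\cfrac{a_n}{b_n}}}$ (for $n=0$ it is $a_0/b_0$). Its numerator and denominator polynomials are the usual ones: here both satisfy $Y_n=(1-b)Y_{n-1}+(b+\lambda q^n)Y_{n-2}$ for $n\ge1$, with numerators starting from $Y_{-1}=0,\ Y_0=1$ and denominators from $Y_{-1}=1,\ Y_0=1-b$. The $q$-binomial coefficient is $\begin{bmatrix}n\\ k\end{bmatrix}_q=\frac{(q;q)_n}{(q;q)_k(q;q)_{n-k}}$ for integers $n\ge k\ge0$, where $(q;q)_n=\prod_{i=1}^n(1-q^i)$, and it is $0$ when $n<k$ (in particular for negative $n$ and $k\ge0$), so the sums are finite. *)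

theory Defs
  imports "HOL-Computational_Algebra.Computational_Algebra" "HOL-Library.Groups_Big_Fun"
begin

definition qpoch :: "'a::comm_ring_1 \<Rightarrow> nat \<Rightarrow> 'a" where
  "qpoch q n = (\<Prod>i=1..n. 1 - q ^ i)"

text \<open>The upper argument is an integer: it becomes negative in the double sums below.\<close>

definition qbinom :: "'a::field \<Rightarrow> int \<Rightarrow> nat \<Rightarrow> 'a" where
  "qbinom q n k =
     (if n < int k then 0 else qpoch q (nat n) / (qpoch q k * qpoch q (nat n - k)))"

text \<open>Sums over all pairs of natural numbers. \<^const>\<open>Sum_any\<close> is the sum of a finitely
  supported family; the supports here are finite because the second \<open>q\<close>-binomial vanishes
  for large \<open>k\<close> or \<open>j\<close>.\<close>

definition Nsum :: "'a::field \<Rightarrow> 'a \<Rightarrow> 'a \<Rightarrow> nat \<Rightarrow> 'a" where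
  "Nsum q b l n = Sum_any (\<lambda>(k::nat, j::nat).
     q ^ (k\<^sup>2 + k) * l ^ k * qbinom q (int k + int j) k
       * qbinom q (int n - int k - int j) k * (- b) ^ j)"

definition Dsum :: "'a::field \<Rightarrow> 'a \<Rightarrow> 'a \<Rightarrow> nat \<Rightarrow> 'a" where
  "Dsum q b l n = Sum_any (\<lambda>(k::nat, j::nat).
     q ^ (k\<^sup>2) * l ^ k * qbinom q (int k + int j) k
       * qbinom q (int n - int k - int j + 1) k * (- b) ^ j)"

text \<open>\<open>cfrac a d n\<close> is the value of \<open>a\<^sub>0/(d\<^sub>0 + a\<^sub>1/(d\<^sub>1 + \<cdots> + a\<^sub>n/d\<^sub>n))\<close>. As \<open>x / 0 = 0\<close> in HOL,
  \<open>cfrac_defined a d n\<close> records that no division by zero occurs in it.\<close>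

fun cfrac :: "(nat \<Rightarrow> 'a::field) \<Rightarrow> (nat \<Rightarrow> 'a) \<Rightarrow> nat \<Rightarrow> 'a" where
  "cfrac a d 0 = a 0 / d 0"
| "cfrac a d (Suc n) = a 0 / (d 0 + cfrac (\<lambda>i. a (Suc i)) (\<lambda>i. d (Suc i)) n)"

fun cfrac_defined :: "(nat \<Rightarrow> 'a::field) \<Rightarrow> (nat \<Rightarrow> 'a) \<Rightarrow> nat \<Rightarrow> bool" where
  "cfrac_defined a d 0 \<longleftrightarrow> d 0 \<noteq> 0"
| "cfrac_defined a d (Suc n) \<longleftrightarrow>
     cfrac_defined (\<lambda>i. a (Suc i)) (\<lambda>i. d (Suc i)) n \<and>
     d 0 + cfrac (\<lambda>i. a (Suc i)) (\<lambda>i. d (Suc i)) n \<noteq> 0"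

text \<open>The sequence \<open>Y\<close> with \<open>Y\<^sub>n = d\<^sub>n Y\<^sub>n\<^sub>-\<^sub>1 + a\<^sub>n Y\<^sub>n\<^sub>-\<^sub>2\<close> for \<open>n \<ge> 1\<close>, where \<open>Y\<^sub>-\<^sub>1 = u\<close> and \<open>Y\<^sub>0 = v\<close>.\<close>

fun conv_rec :: "(nat \<Rightarrow> 'a::comm_ring_1) \<Rightarrow> (nat \<Rightarrow> 'a) \<Rightarrow> 'a \<Rightarrow> 'a \<Rightarrow> nat \<Rightarrow> 'a" where
  "conv_rec a d u v 0 = v"
| "conv_rec a d u v (Suc 0) = d 1 * v + a 1 * u"
| "conv_rec a d u v (Suc (Suc n)) =
     d (Suc (Suc n)) * conv_rec a d u v (Suc n) + a (Suc (Suc n)) * conv_rec a d u v n"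

definition conv_num :: "(nat \<Rightarrow> 'a::comm_ring_1) \<Rightarrow> (nat \<Rightarrow> 'a) \<Rightarrow> nat \<Rightarrow> 'a" where
  "conv_num a d = conv_rec a d 0 (a 0)"

definition conv_den :: "(nat \<Rightarrow> 'a::comm_ring_1) \<Rightarrow> (nat \<Rightarrow> 'a) \<Rightarrow> nat \<Rightarrow> 'a" where
  "conv_den a d = conv_rec a d 1 (d 0)"

definition pnum :: "'a::comm_ring_1 \<Rightarrow> 'a \<Rightarrow> 'a \<Rightarrow> nat \<Rightarrow> 'a" where
  "pnum q b l i = (if i = 0 then 1 else b + l * q ^ i)"

definition pden :: "'a::comm_ring_1 \<Rightarrow> nat \<Rightarrow> 'a" where
  "pden b i = 1 - b"

text \<open>The three indeterminates, as elements of \<open>R[q][b][\<lambda>]\<close>.\<close>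

definition ind_q :: "'a::idom poly poly poly" where "ind_q = [:[:[:0, 1:]:]:]"
definition ind_b :: "'a::idom poly poly poly" where "ind_b = [:[:0, 1:]:]"
definition ind_l :: "'a::idom poly poly poly" where "ind_l = [:0, 1:]"

end

theory Submission
  imports Defs
begin

text \<open>
  The sums satisfy the three-term recurrence because their generating functions satisfy a
  \<open>q\<close>-difference equation. If \<open>Y\<^sub>n\<^sub>+\<^sub>2 = (1 - b) Y\<^sub>n\<^sub>+\<^sub>1 + (b + \<lambda> q\<^sup>n\<^sup>+\<^sup>1\<^sup>+\<^sup>e) Y\<^sub>n\<close> with
  \<open>Y\<^sub>0 = 1\<close> and \<open>Y\<^sub>1 = 1 - b\<close>, then \<open>F(x) = \<Sum> Y\<^sub>n x\<^sup>n\<close> obeys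
  \<open>(1 - x)(1 + b x) F(x) = 1 + \<lambda> q\<^sup>1\<^sup>+\<^sup>e x\<^sup>2 F(q x)\<close>, and iterating this gives
  \<open>F(x) = \<Sum>\<^sub>k q^(k\<^sup>2 + e k) \<lambda>\<^sup>k x^(2 k) P\<^sub>k(x)\<close> with
  \<open>P\<^sub>k(x) = 1 / \<Prod>\<^sub>i\<^sub>\<le>\<^sub>k (1 - x q\<^sup>i)(1 + b x q\<^sup>i)\<close>. By the \<open>q\<close>-binomial theorem each of the two
  products has Gaussian binomials as the coefficients of its inverse, so that the coefficient of
  \<open>x\<^sup>n\<close> in \<open>F\<close> is the double sum: \<open>e = 1\<close> gives the numerator at \<open>n\<close>, and \<open>e = 0\<close> gives the
  denominator at \<open>n - 1\<close>. The proof runs this backwards: \<open>P\<^sub>k\<close> is defined from Gaussian binomials,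
  the \<open>q\<close>-Pascal rule yields \<open>(1 - x)(1 + b x) P\<^sub>k\<^sub>+\<^sub>1(x) = P\<^sub>k(q x)\<close> (\<open>qbinom_prod_fps_Suc\<close>), and
  comparing coefficients and summing over \<open>k\<close> gives the recurrence (\<open>rr_sum_rec\<close>).

  A continued fraction is the quotient of its convergent polynomials, with no division by zero,
  as soon as the denominators of all its tails are nonzero (\<open>cfrac_eq_convergent\<close>). Here they are
  nonzero polynomials since each takes the value 1 at \<open>b = \<lambda> = 0\<close>.
\<close>

section \<open>Convergents of a continued fraction\<close>

lemma conv_rec_shift:
  "conv_rec a d u v (Suc n) =
     conv_rec (\<lambda>i. a (Suc i)) (\<lambda>i. d (Suc i)) v (d 1 * v + a 1 * u) n"
  by (induction a d u v n rule: conv_rec.induct) (simp_all add: algebra_simps)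

lemma conv_rec_linear:
  "conv_rec a d (s * u + t * u') (s * v + t * v') n =
     s * conv_rec a d u v n + t * conv_rec a d u' v' n"
  by (induction a d u v n rule: conv_rec.induct) (simp_all add: algebra_simps)

text \<open>The recursion of \<open>cfrac\<close> removes the first partial quotient, whereas \<open>conv_rec\<close> appends a last
  one. Shifting the recurrence by one step and splitting its initial values by linearity turns
  the latter into the former; this is the rule for composing the Moebius maps.\<close>

lemma conv_num_Suc:
  "conv_num a d (Suc n) = a 0 * conv_den (\<lambda>i. a (Suc i)) (\<lambda>i. d (Suc i)) n"
  using conv_rec_linear[of "\<lambda>i. a (Suc i)" "\<lambda>i. d (Suc i)" "a 0" 1 0 0 "d 1" 0 n]
  by (simp add: conv_num_def conv_den_def conv_rec_shift mult.commute)

lemma conv_den_Suc: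
  "conv_den a d (Suc n) =
     d 0 * conv_den (\<lambda>i. a (Suc i)) (\<lambda>i. d (Suc i)) n
       + conv_num (\<lambda>i. a (Suc i)) (\<lambda>i. d (Suc i)) n"
  using conv_rec_linear[of "\<lambda>i. a (Suc i)" "\<lambda>i. d (Suc i)" "d 0" 1 1 0 "d 1" "a 1" n]
  by (simp add: conv_num_def conv_den_def conv_rec_shift mult.commute)

text \<open>The hypothesis quantifies over all shifts \<open>m\<close>: each quantity divided by in the continued
  fraction is the quotient of the denominators of two successive tails. Being closed under a
  further shift, it also passes to the induction hypothesis.\<close>

lemma cfrac_eq_convergent:
  fixes a d :: "nat \<Rightarrow> 'a::field"
  assumes "\<And>m k. conv_den (\<lambda>i. a (m + i)) (\<lambda>i. d (m + i)) k \<noteq> 0"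
  shows "cfrac_defined a d n \<and> cfrac a d n = conv_num a d n / conv_den a d n"
  using assms
proof (induction n arbitrary: a d)
  case 0
  from 0[of 0 0] show ?case by (simp add: conv_num_def conv_den_def)
next
  case (Suc n)
  let ?a = "\<lambda>i. a (Suc i)" and ?d = "\<lambda>i. d (Suc i)"
  have IH: "cfrac_defined ?a ?d n" "cfrac ?a ?d n = conv_num ?a ?d n / conv_den ?a ?d n"
    using Suc.IH[of ?a ?d] Suc.prems[of "Suc _"] by simp_all
  have tail: "conv_den ?a ?d n \<noteq> 0" using Suc.prems[of 1 n] by simp
  have whole: "conv_den a d (Suc n) \<noteq> 0" using Suc.prems[of 0 "Suc n"] by simp
  have "d 0 + cfrac ?a ?d n = conv_den a d (Suc n) / conv_den ?a ?d n"
    using tail by (simp add: IH(2) conv_den_Suc field_simps)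
  with IH(1) tail whole show ?case by (simp add: conv_num_Suc)
qed

lemma conv_rec_hom:
  assumes "\<And>x y. h (x + y) = h x + h y" and "\<And>x y. h (x * y) = h x * h y"
  shows "h (conv_rec a d u v n) = conv_rec (\<lambda>i. h (a i)) (\<lambda>i. h (d i)) (h u) (h v) n"
  by (induction a d u v n rule: conv_rec.induct) (simp_all add: assms)

lemma conv_rec_eqI:
  assumes "Y 0 = v" and "Y 1 = d 1 * v + a 1 * u"
    and "\<And>n. Y (Suc (Suc n)) = d (Suc (Suc n)) * Y (Suc n) + a (Suc (Suc n)) * Y n"
  shows "conv_rec a d u v n = Y n"
  using assms by (induction a d u v n rule: conv_rec.induct) simp_all

section \<open>Generating functions of Gaussian binomials\<close>

lemma qpoch_Suc: "qpoch q (Suc n) = qpoch q n * (1 - q ^ Suc n)"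
  by (simp add: qpoch_def)

lemma qpoch_nonzero:
  fixes q :: "'a::idom"
  assumes "\<And>i. q ^ Suc i \<noteq> 1"
  shows "qpoch q n \<noteq> 0"
proof (induction n)
  case (Suc n)
  with assms[of n] show ?case by (simp add: qpoch_Suc del: power_Suc)
qed (simp add: qpoch_def)

lemma qbinom_add: "qbinom q (int k + int i) k = qpoch q (k + i) / (qpoch q k * qpoch q i)"
  by (simp add: qbinom_def nat_add_distrib)

text \<open>Distinctness of the positive powers of \<open>q\<close> from 1 is what makes the quotients of \<open>q\<close>-factorials
  behave as Gaussian binomials. After division by the common factors, the rule is
  \<open>1 - q^(k + i + 2) = (1 - q^(i + 1)) + q^(i + 1) (1 - q^(k + 1))\<close>.\<close>

lemma qbinom_pascal:
  fixes q :: "'a::field"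
  assumes "\<And>i. q ^ Suc i \<noteq> 1"
  shows "qbinom q (int (Suc k) + int (Suc i)) (Suc k) =
    qbinom q (int (Suc k) + int i) (Suc k) + q ^ Suc i * qbinom q (int k + int (Suc i)) k"
proof -
  have nz: "qpoch q k \<noteq> 0" "qpoch q i \<noteq> 0" "1 - q ^ Suc k \<noteq> 0" "1 - q ^ Suc i \<noteq> 0"
    using qpoch_nonzero[OF assms] assms[of k] assms[of i] by auto
  have s: "q ^ Suc (k + Suc i) = q ^ Suc k * q ^ Suc i" by (simp add: power_add)
  have e: "Suc k + Suc i = Suc (k + Suc i)" "Suc k + i = k + Suc i" by simp_all
  show ?thesis
    unfolding qbinom_add e qpoch_Suc s using nz
    by (simp add: divide_simps del: power_Suc) (simp add: algebra_simps)
qed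

text \<open>This is the expansion of \<open>1 / \<Prod>\<^sub>i\<^sub>\<le>\<^sub>k (1 - t q\<^sup>i x)\<close>, which the next lemmas establish by peeling
  off one linear factor at a time. The argument scaling \<open>t\<close> is a parameter so that \<open>x \<mapsto> q x\<close> is
  just \<open>t \<mapsto> q t\<close>.\<close>

definition qbinom_fps :: "'a::field \<Rightarrow> 'a \<Rightarrow> nat \<Rightarrow> 'a fps" where
  "qbinom_fps q t k = Abs_fps (\<lambda>i. t ^ i * qbinom q (int k + int i) k)"

lemma qbinom_fps_nth:
  "qbinom_fps q t k $ i = t ^ i * (qpoch q (k + i) / (qpoch q k * qpoch q i))"
  by (simp only: qbinom_fps_def fps_nth_Abs_fps qbinom_add)

lemma qbinom_fps_nth_0:
  assumes "\<And>i. q ^ Suc i \<noteq> 1"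
  shows "qbinom_fps q t k $ 0 = 1"
  using qpoch_nonzero[OF assms, of k] by (simp add: qbinom_fps_nth qpoch_def)

lemma qbinom_fps_Suc:
  assumes "\<And>i. q ^ Suc i \<noteq> 1"
  shows "(1 - fps_const t * fps_X) * qbinom_fps q t (Suc k) = qbinom_fps q (q * t) k"
proof (rule fps_ext)
  fix i
  show "((1 - fps_const t * fps_X) * qbinom_fps q t (Suc k)) $ i = qbinom_fps q (q * t) k $ i"
  proof (cases i)
    case 0
    then show ?thesis by (simp add: qbinom_fps_nth_0[OF assms])
  next
    case (Suc j)
    then show ?thesis
      using qbinom_pascal[OF assms, of k j]
      by (simp add: qbinom_fps_def algebra_simps power_mult_distrib)
  qed
qed

lemma qbinom_fps_0:
  assumes "\<And>i. q ^ Suc i \<noteq> 1"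
  shows "(1 - fps_const t * fps_X) * qbinom_fps q t 0 = 1"
proof (rule fps_ext)
  fix i
  show "((1 - fps_const t * fps_X) * qbinom_fps q t 0) $ i = 1 $ i"
    using qpoch_nonzero[OF assms]
    by (cases i) (simp_all add: qbinom_fps_nth left_diff_distrib mult.assoc qpoch_def[of q 0])
qed

definition qbinom_prod_fps :: "'a::field \<Rightarrow> 'a \<Rightarrow> nat \<Rightarrow> 'a fps" where
  "qbinom_prod_fps q b k = qbinom_fps q 1 k * qbinom_fps q (- b) k"

lemma one_minus_neg_X:
  "1 - fps_const (- b) * fps_X = 1 + fps_const b * (fps_X :: 'a::comm_ring_1 fps)"
  by (simp only: fps_const_neg[symmetric]) simp

lemma qbinom_prod_fps_0:
  assumes "\<And>i. q ^ Suc i \<noteq> 1"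
  shows "(1 - fps_X) * (1 + fps_const b * fps_X) * qbinom_prod_fps q b 0 = 1"
proof -
  have "(1 - fps_X) * (1 + fps_const b * fps_X) * qbinom_prod_fps q b 0
      = ((1 - fps_const 1 * fps_X) * qbinom_fps q 1 0)
        * ((1 - fps_const (- b) * fps_X) * qbinom_fps q (- b) 0)"
    unfolding qbinom_prod_fps_def one_minus_neg_X fps_const_1_eq_1 mult_1 by (simp only: ac_simps)
  then show ?thesis by (simp only: qbinom_fps_0[OF assms] mult_1)
qed

lemma qbinom_prod_fps_Suc:
  assumes "\<And>i. q ^ Suc i \<noteq> 1"
  shows "((1 - fps_X) * (1 + fps_const b * fps_X) * qbinom_prod_fps q b (Suc k)) $ n
       = q ^ n * qbinom_prod_fps q b k $ n"
proof -
  have "(1 - fps_X) * (1 + fps_const b * fps_X) * qbinom_prod_fps q b (Suc k)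
      = ((1 - fps_const 1 * fps_X) * qbinom_fps q 1 (Suc k))
        * ((1 - fps_const (- b) * fps_X) * qbinom_fps q (- b) (Suc k))"
    unfolding qbinom_prod_fps_def one_minus_neg_X fps_const_1_eq_1 mult_1 by (simp only: ac_simps)
  also have "\<dots> = qbinom_fps q (q * 1) k * qbinom_fps q (q * - b) k"
    by (simp only: qbinom_fps_Suc[OF assms])
  also have "\<dots> $ n = q ^ n * qbinom_prod_fps q b k $ n"
    unfolding qbinom_prod_fps_def fps_mult_nth sum_distrib_left
  proof (rule sum.cong)
    fix i assume "i \<in> {0..n}"
    then have "q ^ n = q ^ i * q ^ (n - i)" by (simp flip: power_add)
    then show "qbinom_fps q (q * 1) k $ i * qbinom_fps q (q * - b) k $ (n - i)
        = q ^ n * (qbinom_fps q 1 k $ i * qbinom_fps q (- b) k $ (n - i))"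
      by (simp add: qbinom_fps_def power_mult_distrib flip: mult_minus_right)
  qed simp
  finally show ?thesis .
qed

section \<open>The double sums\<close>

text \<open>The coefficient of \<open>x\<^sup>n\<close> in \<open>x^(2 k) P\<^sub>k(x)\<close>.\<close>

definition qbinom_conv :: "'a::field \<Rightarrow> 'a \<Rightarrow> nat \<Rightarrow> nat \<Rightarrow> 'a" where
  "qbinom_conv q b k n = (if n < 2 * k then 0 else qbinom_prod_fps q b k $ (n - 2 * k))"

text \<open>Multiplication by \<open>(1 - x)(1 + b x)\<close> is the difference operator of the recurrence. On
  \<open>x^(2 k) P\<^sub>k(x)\<close> it leaves \<open>x^(2 k) P\<^sub>k\<^sub>-\<^sub>1(q x)\<close>, whose coefficients are those belonging to
  \<open>k - 1\<close>, moved up by two places and scaled by a power of \<open>q\<close>; for \<open>k = 0\<close> it leaves the constant 1, which does not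
  contribute at \<open>n + 2\<close>.\<close>

lemma qbinom_conv_rec:
  assumes "\<And>i. q ^ Suc i \<noteq> 1"
  shows "qbinom_conv q b k (Suc (Suc n)) =
     (1 - b) * qbinom_conv q b k (Suc n) + b * qbinom_conv q b k n
       + (if k = 0 \<or> n < 2 * (k - 1) then 0
          else q ^ (n - 2 * (k - 1)) * qbinom_conv q b (k - 1) n)"
proof -
  have X: "qbinom_conv q b k n = (fps_X ^ (2 * k) * qbinom_prod_fps q b k) $ n" for k n
    by (simp add: qbinom_conv_def fps_X_power_mult_nth)
  have "((1 - fps_X) * (1 + fps_const b * fps_X) * (fps_X ^ (2 * k) * qbinom_prod_fps q b k)) $ Suc (Suc n)
     = qbinom_conv q b k (Suc (Suc n)) - ((1 - b) * qbinom_conv q b k (Suc n) + b * qbinom_conv q b k n)"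
    (is "(?f * _) $ _ = _")
  proof -
    have "?f = 1 - fps_const (1 - b) * fps_X - fps_const b * (fps_X * fps_X)"
      by (simp add: algebra_simps flip: fps_const_sub)
    then show ?thesis
      by (simp add: X left_diff_distrib mult.assoc) (simp add: algebra_simps)
  qed
  moreover have "(?f * (fps_X ^ (2 * k) * qbinom_prod_fps q b k)) $ Suc (Suc n)
     = (fps_X ^ (2 * k) * (?f * qbinom_prod_fps q b k)) $ Suc (Suc n)"
    by (simp only: ac_simps)
  moreover have "\<dots> = (if k = 0 \<or> n < 2 * (k - 1) then 0
          else q ^ (n - 2 * (k - 1)) * qbinom_conv q b (k - 1) n)"
  proof (cases k)
    case 0
    then show ?thesis by (simp add: qbinom_prod_fps_0[OF assms])
  next
    case (Suc m)
    then show ?thesis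
      unfolding fps_X_power_mult_nth by (simp add: qbinom_prod_fps_Suc[OF assms] qbinom_conv_def)
  qed
  ultimately show ?thesis by simp
qed

definition rr_sum :: "'a::field \<Rightarrow> 'a \<Rightarrow> 'a \<Rightarrow> nat \<Rightarrow> nat \<Rightarrow> 'a" where
  "rr_sum q b l e n = (\<Sum>k\<le>n. q ^ (k\<^sup>2 + e * k) * l ^ k * qbinom_conv q b k n)"

text \<open>A common range of summation lets the terms of the recurrence be compared for each \<open>k\<close>.\<close>

lemma rr_sum_extend:
  assumes "n \<le> m"
  shows "rr_sum q b l e n = (\<Sum>k\<le>m. q ^ (k\<^sup>2 + e * k) * l ^ k * qbinom_conv q b k n)"
  unfolding rr_sum_def using assms
  by (intro sum.mono_neutral_left) (auto simp: qbinom_conv_def)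

text \<open>The weights are such that \<open>q^((k + 1)\<^sup>2 + e (k + 1)) q^(n - 2 k) = q^(n + 1 + e) q^(k\<^sup>2 + e k)\<close>:
  after reindexing, the factor in front of the inhomogeneous terms does not depend on \<open>k\<close>, and
  these terms add up to a multiple of the sum at \<open>n\<close>.\<close>

lemma rr_sum_rec:
  assumes "\<And>i. q ^ Suc i \<noteq> 1"
  shows "rr_sum q b l e (Suc (Suc n)) =
     (1 - b) * rr_sum q b l e (Suc n) + (b + l * q ^ (n + 1 + e)) * rr_sum q b l e n"
proof -
  let ?M = "Suc (Suc n)"
  let ?w = "\<lambda>k. q ^ (k\<^sup>2 + e * k) * l ^ k"
  let ?r = "\<lambda>k. if k = 0 \<or> n < 2 * (k - 1) then 0
          else q ^ (n - 2 * (k - 1)) * qbinom_conv q b (k - 1) n"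
  have "(\<Sum>k\<le>?M. ?w k * ?r k) = (\<Sum>k\<le>Suc n. ?w (Suc k) * ?r (Suc k))"
    by (subst sum.atMost_Suc_shift) simp
  also have "\<dots> = (\<Sum>k\<le>Suc n. l * q ^ (n + 1 + e) * (?w k * qbinom_conv q b k n))"
  proof (rule sum.cong[OF refl])
    fix k
    show "?w (Suc k) * ?r (Suc k) = l * q ^ (n + 1 + e) * (?w k * qbinom_conv q b k n)"
    proof (cases "n < 2 * k")
      case False
      then have "(Suc k)\<^sup>2 + e * Suc k + (n - 2 * k) = (n + 1 + e) + (k\<^sup>2 + e * k)"
        by (simp add: power2_eq_square)
      then have "q ^ ((Suc k)\<^sup>2 + e * Suc k) * q ^ (n - 2 * k) = q ^ (n + 1 + e) * q ^ (k\<^sup>2 + e * k)"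
        by (simp only: flip: power_add)
      with False show ?thesis by (simp del: power_Suc add: power_Suc[of l] ac_simps)
    qed (simp add: qbinom_conv_def)
  qed
  also have "\<dots> = l * q ^ (n + 1 + e) * rr_sum q b l e n"
    by (simp only: rr_sum_extend[of n "Suc n"] sum_distrib_left)
  finally have r: "(\<Sum>k\<le>?M. ?w k * ?r k) = l * q ^ (n + 1 + e) * rr_sum q b l e n" .
  have "rr_sum q b l e ?M = (\<Sum>k\<le>?M. (1 - b) * (?w k * qbinom_conv q b k (Suc n))
      + b * (?w k * qbinom_conv q b k n) + ?w k * ?r k)"
    unfolding rr_sum_def qbinom_conv_rec[OF assms]
    by (intro sum.cong refl) (simp add: algebra_simps)
  also have "\<dots> = (1 - b) * rr_sum q b l e (Suc n) + b * rr_sum q b l e n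
      + (\<Sum>k\<le>?M. ?w k * ?r k)"
    by (simp only: sum.distrib sum_distrib_left rr_sum_extend[of n ?M] rr_sum_extend[of "Suc n" ?M])
  finally show ?thesis unfolding r by (simp add: algebra_simps)
qed

lemma rr_sum_0: "rr_sum q b l e 0 = 1"
  by (simp add: rr_sum_def qbinom_conv_def qbinom_prod_fps_def qbinom_fps_def qbinom_def qpoch_def)

lemma rr_sum_1:
  assumes "\<And>i. q ^ Suc i \<noteq> 1"
  shows "rr_sum q b l e 1 = 1 - b"
  using assms[of 0]
  by (simp add: rr_sum_def qbinom_conv_def qbinom_prod_fps_def qbinom_fps_def qbinom_def
      qpoch_def fps_mult_nth)

text \<open>This is the Cauchy product of the two series: the \<open>j\<close>th coefficient of the one in \<open>- b x\<close>
  meets the coefficient with index \<open>i = n - 2 k - j\<close> of the other, and \<open>k + i = n - k - j\<close>.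
  The second Gaussian binomial vanishes for \<open>j > n - 2 k\<close>.\<close>

lemma qbinom_conv_eq_sum:
  "qbinom_conv q b k n =
     (\<Sum>j\<le>n. qbinom q (int k + int j) k * qbinom q (int n - int k - int j) k * (- b) ^ j)"
proof (cases "n < 2 * k")
  case True
  then show ?thesis by (simp add: qbinom_conv_def qbinom_def)
next
  case False
  have "(\<Sum>j\<le>n. qbinom q (int k + int j) k * qbinom q (int n - int k - int j) k * (- b) ^ j)
     = (\<Sum>j\<le>n - 2 * k. qbinom q (int k + int j) k * qbinom q (int n - int k - int j) k * (- b) ^ j)"
    using False by (intro sum.mono_neutral_right) (auto simp: qbinom_def)
  also have "\<dots> = (\<Sum>j=0..n - 2 * k. qbinom_fps q (- b) k $ j * qbinom_fps q 1 k $ (n - 2 * k - j))"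
  proof (rule sum.cong)
    fix j assume "j \<in> {0..n - 2 * k}"
    with False have e: "int n - int k - int j = int k + int (n - 2 * k - j)" by auto
    show "qbinom q (int k + int j) k * qbinom q (int n - int k - int j) k * (- b) ^ j =
        qbinom_fps q (- b) k $ j * qbinom_fps q 1 k $ (n - 2 * k - j)"
      unfolding e qbinom_fps_def by simp
  qed auto
  also have "\<dots> = qbinom_conv q b k n"
    unfolding fps_mult_nth[symmetric] using False
    by (simp add: qbinom_conv_def qbinom_prod_fps_def mult.commute)
  finally show ?thesis by simp
qed

lemma rr_sum_eq_Sum_any:
  "Sum_any (\<lambda>(k, j). q ^ (k\<^sup>2 + e * k) * l ^ k * qbinom q (int k + int j) k
       * qbinom q (int n - int k - int j) k * (- b) ^ j) = rr_sum q b l e n"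
  (is "Sum_any ?f = _")
proof -
  have "Sum_any ?f = sum ?f ({..n} \<times> {..n})"
    by (rule Sum_any.expand_superset) (auto simp: qbinom_def split: if_splits)
  also have "\<dots> = rr_sum q b l e n"
    unfolding rr_sum_def qbinom_conv_eq_sum
    by (simp add: sum.cartesian_product[symmetric] sum_distrib_left mult.assoc)
  finally show ?thesis .
qed

lemma Nsum_eq_rr_sum: "Nsum q b l n = rr_sum q b l 1 n"
  using rr_sum_eq_Sum_any[of q 1 l n b] by (simp add: Nsum_def)

lemma Dsum_eq_rr_sum: "Dsum q b l n = rr_sum q b l 0 (Suc n)"
proof -
  have "int n - int k - int j + 1 = int (Suc n) - int k - int j" for k j by simp
  then show ?thesis
    using rr_sum_eq_Sum_any[of q 0 l "Suc n" b] by (simp only: Dsum_def) simp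
qed

lemma Nsum_eq_conv_num:
  assumes "\<And>i. q ^ Suc i \<noteq> 1"
  shows "Nsum q b l n = conv_num (pnum q b l) (pden b) n"
  unfolding conv_num_def Nsum_eq_rr_sum
  by (rule conv_rec_eqI[symmetric])
     (simp_all add: rr_sum_0 rr_sum_1[OF assms, simplified]
        rr_sum_rec[OF assms] pnum_def pden_def)

text \<open>The shift by one makes the fictitious initial value \<open>Y\<^sub>-\<^sub>1 = 1\<close> of the denominators the honest
  value of the sum at 0.\<close>

lemma Dsum_eq_conv_den:
  assumes "\<And>i. q ^ Suc i \<noteq> 1"
  shows "Dsum q b l n = conv_den (pnum q b l) (pden b) n"
  unfolding conv_den_def Dsum_eq_rr_sum
  by (rule conv_rec_eqI[symmetric])
     (simp_all add: rr_sum_0 rr_sum_1[OF assms, simplified]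
        rr_sum_rec[OF assms] pnum_def pden_def)

section \<open>Indeterminates\<close>

lemma ind_q_power_neq_1: "ind_q ^ Suc i \<noteq> 1"
proof
  assume "ind_q ^ Suc i = (1 :: 'a poly poly poly)"
  then have "poly (poly (poly (ind_q ^ Suc i) 0) 0) 0 = (poly (poly (poly 1 0) 0) 0 :: 'a)"
    by (simp only:)
  then show False by (simp add: ind_q_def)
qed

text \<open>At \<open>b = \<lambda> = 0\<close> the partial numerators become 0 and the partial denominators 1, except for
  the initial partial numerator, which does not enter a denominator.\<close>

lemma conv_den_shift_nonzero:
  fixes q :: "'r::idom poly poly poly"
  shows "conv_den (\<lambda>i. pnum q ind_b ind_l (m + i)) (\<lambda>i. pden ind_b (m + i)) n \<noteq> 0"
proof -
  let ?h = "\<lambda>p :: 'r poly poly poly. poly (poly p 0) 0"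
  let ?a = "\<lambda>i. pnum q ind_b ind_l (m + i)" and ?d = "\<lambda>i. pden ind_b (m + i)"
  have "?h (conv_den ?a ?d n) = conv_rec (\<lambda>i. ?h (?a i)) (\<lambda>i. ?h (?d i)) (?h 1) (?h (?d 0)) n"
    unfolding conv_den_def by (rule conv_rec_hom) simp_all
  also have "\<dots> = 1"
    by (rule conv_rec_eqI) (simp_all add: pnum_def pden_def ind_b_def ind_l_def)
  finally show ?thesis by auto
qed

theorem mainTheorem7:
  fixes q b l :: "'r::idom poly poly poly" and Q B L :: "'r poly poly poly fract" and n :: nat
  assumes "q = ind_q" and "b = ind_b" and "l = ind_l"
    and "Q = to_fract q" and "B = to_fract b" and "L = to_fract l"
  shows "Nsum Q B L n = to_fract (conv_num (pnum q b l) (pden b) n) \<and>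
         Dsum Q B L n = to_fract (conv_den (pnum q b l) (pden b) n) \<and>
         Dsum Q B L n \<noteq> 0 \<and>
         cfrac_defined (pnum Q B L) (pden B) n \<and>
         Nsum Q B L n / Dsum Q B L n = cfrac (pnum Q B L) (pden B) n"
proof -
  have pow: "to_fract (x ^ i) = to_fract x ^ i" for x :: "'r poly poly poly" and i
    by (induction i) simp_all
  have Q: "Q ^ Suc i \<noteq> 1" for i
    using ind_q_power_neq_1[of i, where ?'a = 'r] assms(1,4)
    by (metis pow to_fract_1 to_fract_eq_iff)
  have hom: "to_fract (conv_rec a d u v n) =
      conv_rec (\<lambda>i. to_fract (a i)) (\<lambda>i. to_fract (d i)) (to_fract u) (to_fract v) n"
    for a d u v n
    by (rule conv_rec_hom) simp_all
  have a: "to_fract (pnum q b l i) = pnum Q B L i" for i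
    by (simp add: pnum_def assms(4-6) pow)
  have d: "to_fract (pden b i) = pden B i" for i
    by (simp add: pden_def assms(5))
  have num: "to_fract (conv_num (pnum q b l) (pden b) n) = conv_num (pnum Q B L) (pden B) n"
    by (simp add: conv_num_def hom a d)
  have den: "to_fract (conv_den (\<lambda>i. pnum q b l (m + i)) (\<lambda>i. pden b (m + i)) k)
      = conv_den (\<lambda>i. pnum Q B L (m + i)) (\<lambda>i. pden B (m + i)) k" for m k
    by (simp add: conv_den_def hom a d)
  have nz: "conv_den (\<lambda>i. pnum Q B L (m + i)) (\<lambda>i. pden B (m + i)) k \<noteq> 0" for m k
    using conv_den_shift_nonzero[of q m k] by (simp add: assms(2,3) flip: den)
  show ?thesis
    using Nsum_eq_conv_num[OF Q] Dsum_eq_conv_den[OF Q] num den[of 0 n] nz[of 0 n]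
      cfrac_eq_convergent[OF nz]
    by simp
qed

end
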